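(* Let $(\alpha,m)\in(0,1)^2$, let $\mu$ be the Lebesgue measure on $\mathbb{R}$, and let $f$ be a continuous function with values in $[0,\infty)$, defined on $[a,a+\eta(b,a)]\cup\big[\frac{a}{m},\frac{a+\eta(b,a)}{m}\big]$, which is $(\alpha,m)$-preinvex on $[a,a+\eta(b,a)]$ with respect to $\eta$ and satisfies $f(a)\le f(a+\eta(b,a))$. Then $$(s)\int_{a}^{a+\eta(b,a)} f(x)\,d\mu\le\min\{\beta,\eta(b,a)\},$$ where $\beta\in[0,\eta(b,a)]$ satisfies the equation $$(\eta(b,a)-\beta)^\alpha\, m f\Big(\frac{a+\eta(b,a)}{m}\Big)-(\eta(b,a)-\beta)^\alpha f(a)-\eta(b,a)^\alpha(\beta-f(a))=0.$$
   Context: For a measurable $f\ge 0$ and a measurable set $A$, the Sugeno (fuzzy) integral is $(s)\int_A f\,d\mu=\sup_{\gamma\ge 0}\min\{\gamma,\mu(A\cap\{x: f(x)\ge\gamma\})\}$; $(s)\int_c^d$ means $A=[c,d]$. Setting: $K\subset[0,b^*]$ (for some $b^*>0$) is a nonempty closed set, $\eta:K\times K\to\mathbb{R}$ is continuous, and $K$ is invex with respect to $\eta$, i.e. $u+t\eta(v,u)\in K$ for all $u,v\in K$, $t\in[0,1]$. It is assumed that $a,b\in K$ and $\eta(b,a)>0$ (so $[a,a+\eta(b,a)]\subset K$), and that $\eta$ satisfies Condition C: for all $x,y\in K$ and $t,t_1,t_2\in[0,1]$, $\eta(y,y+t\eta(x,y))=-t\eta(x,y)$, $\eta(x,y+t\eta(x,y))=(1-t)\eta(x,y)$,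 and $\eta(y+t_2\eta(x,y),y+t_1\eta(x,y))=(t_2-t_1)\eta(x,y)$. $f$ is $(\alpha,m)$-preinvex on $[a,a+\eta(b,a)]$ with respect to $\eta$ if $f(u+t\eta(v,u))\le(1-t^\alpha)f(u)+m t^\alpha f\big(\frac{v}{m}\big)$ for all $u,v\in[a,a+\eta(b,a)]$ and $t\in[0,1]$. *)

theory Defs
  imports "HOL-Analysis.Analysis"
begin

text \<open>The Sugeno integral is \<^typ>\<open>ennreal\<close>-valued, since \<open>\<mu>(A \<inter> {f \<ge> \<gamma>})\<close> may be infinite.
  Only the values of \<open>f\<close> on \<open>A\<close> matter, so \<open>f\<close> may be a partial function extended arbitrarily.\<close>

definition sugeno_integral :: "'a measure \<Rightarrow> 'a set \<Rightarrow> ('a \<Rightarrow> real) \<Rightarrow> ennreal" where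
  "sugeno_integral M A f =
     (SUP \<gamma>\<in>{0::real..}. min (ennreal \<gamma>) (emeasure M (A \<inter> {x. f x \<ge> \<gamma>})))"

definition invex :: "real set \<Rightarrow> (real \<Rightarrow> real \<Rightarrow> real) \<Rightarrow> bool" where
  "invex K \<eta> \<longleftrightarrow> (\<forall>u\<in>K. \<forall>v\<in>K. \<forall>t\<in>{0..1}. u + t * \<eta> v u \<in> K)"

definition condition_C :: "real set \<Rightarrow> (real \<Rightarrow> real \<Rightarrow> real) \<Rightarrow> bool" where
  "condition_C K \<eta> \<longleftrightarrow>
     (\<forall>x\<in>K. \<forall>y\<in>K. \<forall>t\<in>{0..1}. \<forall>t1\<in>{0..1}. \<forall>t2\<in>{0..1}.
        \<eta> y (y + t * \<eta> x y) = - t * \<eta> x y \<and>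
        \<eta> x (y + t * \<eta> x y) = (1 - t) * \<eta> x y \<and>
        \<eta> (y + t2 * \<eta> x y) (y + t1 * \<eta> x y) = (t2 - t1) * \<eta> x y)"

text \<open>For \<open>\<alpha> > 0\<close>, \<open>powr\<close> gives the intended value \<open>0 powr \<alpha> = 0\<close> at \<open>t = 0\<close>.\<close>

definition preinvex_on ::
  "real \<Rightarrow> real \<Rightarrow> real set \<Rightarrow> (real \<Rightarrow> real \<Rightarrow> real) \<Rightarrow> (real \<Rightarrow> real) \<Rightarrow> bool" where
  "preinvex_on \<alpha> m S \<eta> f \<longleftrightarrow>
     (\<forall>u\<in>S. \<forall>v\<in>S. \<forall>t\<in>{0..1}.
        f (u + t * \<eta> v u) \<le> (1 - t powr \<alpha>) * f u + m * t powr \<alpha> * f (v / m))"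

end

theory Submission
  imports Defs
begin

text \<open>
  Condition C gives \<open>\<eta>(a + \<eta>(b,a), a) = \<eta>(b,a)\<close>, so preinvexity from \<open>a\<close> towards
  \<open>a + h\<close>, \<open>h = \<eta>(b,a)\<close>, bounds \<open>f(a + t h)\<close> by \<open>g(t) = f(a) + t\<^sup>\<alpha> D\<close> with
  \<open>D = m f((a + h)/m) - f(a)\<close>. At \<open>t = 1\<close> this yields \<open>D \<ge> f(a + h) - f(a) \<ge> 0\<close>, so \<open>g\<close> is
  nondecreasing. The equation for \<open>\<beta>\<close> says \<open>g(1 - \<beta>/h) = \<beta>\<close>; hence \<open>f > \<beta>\<close> only on the last
  piece of the interval, of length \<open>\<beta>\<close>.
\<close>

text \<open>Levels up to \<open>c\<close> are controlled by the first argument of the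
  \<open>min\<close>, so only the superlevel sets above \<open>c\<close> need a measure
  bound.\<close>

lemma sugeno_integral_le:
  assumes "\<And>\<gamma>. \<gamma> > c \<Longrightarrow> emeasure M (A \<inter> {x. f x \<ge> \<gamma>}) \<le> ennreal c"
  shows "sugeno_integral M A f \<le> ennreal c"
  unfolding sugeno_integral_def
proof (rule SUP_least)
  fix \<gamma> :: real
  show "min (ennreal \<gamma>) (emeasure M (A \<inter> {x. f x \<ge> \<gamma>})) \<le> ennreal c"
  proof (cases "\<gamma> \<le> c")
    case True
    then show ?thesis by (simp add: min.coboundedI1 ennreal_leI)
  next
    case False
    then show ?thesis by (simp add: min.coboundedI2 assms)
  qed
qed

text \<open>Third identity of Condition C at \<open>t2 = 1\<close>, \<open>t1 = 0\<close>. It lets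
  \<open>a + \<eta> b a\<close> replace \<open>b\<close> as the target point in preinvexity:
  \<open>b\<close> itself may lie outside the interval.\<close>

lemma condition_C_endpoint:
  assumes "condition_C K \<eta>" "x \<in> K" "y \<in> K"
  shows "\<eta> (y + \<eta> x y) y = \<eta> x y"
proof -
  have "\<eta> (y + 1 * \<eta> x y) (y + 0 * \<eta> x y) = (1 - 0) * \<eta> x y"
    using assms unfolding condition_C_def
    by (metis atLeastAtMost_iff le_numeral_extra(3) le_numeral_extra(4) zero_le_one)
  then show ?thesis by simp
qed

theorem theorem4p4:
  fixes K :: "real set" and \<eta> :: "real \<Rightarrow> real \<Rightarrow> real" and f :: "real \<Rightarrow> real"
    and bstar a b \<alpha> m \<beta> :: real
  assumes "bstar > 0" and "K \<noteq> {}" and "closed K" and "K \<subseteq> {0..bstar}"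
    and "continuous_on (K \<times> K) (\<lambda>(x, y). \<eta> x y)"
    and "invex K \<eta>" and "condition_C K \<eta>"
    and "a \<in> K" and "b \<in> K" and "\<eta> b a > 0"
    and "\<alpha> \<in> {0<..<1}" and "m \<in> {0<..<1}"
    and "continuous_on ({a..a + \<eta> b a} \<union> {a / m..(a + \<eta> b a) / m}) f"
    and "\<And>x. x \<in> {a..a + \<eta> b a} \<union> {a / m..(a + \<eta> b a) / m} \<Longrightarrow> f x \<ge> 0"
    and "preinvex_on \<alpha> m {a..a + \<eta> b a} \<eta> f"
    and "f a \<le> f (a + \<eta> b a)"
    and "\<beta> \<in> {0..\<eta> b a}"
    and "(\<eta> b a - \<beta>) powr \<alpha> * m * f ((a + \<eta> b a) / m) - (\<eta> b a - \<beta>) powr \<alpha> * f a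
           - \<eta> b a powr \<alpha> * (\<beta> - f a) = 0"
  shows "sugeno_integral lebesgue {a..a + \<eta> b a} f \<le> ennreal (min \<beta> (\<eta> b a))"
proof -
  define h where "h = \<eta> b a"
  define D where "D = m * f ((a + h) / m) - f a"
  have h: "h > 0" and b: "0 \<le> \<beta>" "\<beta> \<le> h" using assms(10,17) by (auto simp: h_def)
  have "\<eta> (a + h) a = h"
    unfolding h_def using assms(7-9) by (intro condition_C_endpoint)
  then have bound: "f (a + t * h) \<le> f a + t powr \<alpha> * D" if "t \<in> {0..1}" for t
  proof -
    have "f (a + t * \<eta> (a + h) a) \<le> (1 - t powr \<alpha>) * f a + m * t powr \<alpha> * f ((a + h) / m)"
      using assms(15) that h unfolding preinvex_on_def h_def[symmetric] by simp
    then show ?thesis using \<open>\<eta> (a + h) a = h\<close> by (simp add: D_def algebra_simps)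
  qed
  have "D \<ge> 0" using bound[of 1] assms(16) by (simp add: h_def)
  have \<beta>_eq: "f a + ((h - \<beta>) / h) powr \<alpha> * D = \<beta>"
  proof -
    have "(h - \<beta>) powr \<alpha> * D = h powr \<alpha> * (\<beta> - f a)"
      using assms(18) unfolding h_def[symmetric] by (simp add: D_def algebra_simps)
    \<comment> \<open>Division by \<open>h powr \<alpha>\<close>, which is positive.\<close>
    then show ?thesis using h b by (simp add: powr_divide)
  qed
  have tail: "{a..a + h} \<inter> {x. f x \<ge> \<gamma>} \<subseteq> {a + h - \<beta>..a + h}" if "\<gamma> > \<beta>" for \<gamma>
  proof
    fix x assume x: "x \<in> {a..a + h} \<inter> {x. f x \<ge> \<gamma>}"
    define t where "t = (x - a) / h"
    have t: "t \<in> {0..1}" "x = a + t * h" using x h by (auto simp: t_def field_simps)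
    \<comment> \<open>Up to this threshold monotonicity of the bound gives
      \<open>f x \<le> \<beta>\<close>, against \<open>f x \<ge> \<gamma> > \<beta>\<close>.\<close>
    have "\<not> t \<le> (h - \<beta>) / h"
    proof
      assume "t \<le> (h - \<beta>) / h"
      then have "t powr \<alpha> \<le> ((h - \<beta>) / h) powr \<alpha>"
        using t assms(11) by (intro powr_mono2) auto
      then have "f x \<le> \<beta>"
        using bound[OF t(1)] mult_right_mono[OF _ \<open>D \<ge> 0\<close>] \<beta>_eq t(2) by fastforce
      then show False using x that by simp
    qed
    then have "t * h > h - \<beta>" using h by (simp add: field_simps)
    then show "x \<in> {a + h - \<beta>..a + h}" using x t(2) by simp
  qed
  have "sugeno_integral lebesgue {a..a + h} f \<le> ennreal \<beta>"
  proof (rule sugeno_integral_le)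
    fix \<gamma> assume "\<gamma> > \<beta>"
    then have "emeasure lebesgue ({a..a + h} \<inter> {x. f x \<ge> \<gamma>}) \<le> emeasure lebesgue {a + h - \<beta>..a + h}"
      \<comment> \<open>\<open>emeasure_mono\<close> asks for measurability of the larger set, here
        an interval.\<close>
      by (intro emeasure_mono tail) auto
    also have "\<dots> = ennreal \<beta>" using b by simp
    finally show "emeasure lebesgue ({a..a + h} \<inter> {x. f x \<ge> \<gamma>}) \<le> ennreal \<beta>" .
  qed
  \<comment> \<open>Since \<open>\<beta> \<le> h\<close>, the minimum in the claim is
    \<open>\<beta>\<close>.\<close>
  then show ?thesis using b by (simp add: h_def min_def)
qed

end
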